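(* Let $\Sigma$ be a finite alphabet and, for $m\in\mathbb{Z}^+$, let $C(m)=\{w\mid w\in\Sigma^m\}$ be the language of all words over $\Sigma$ of length $m$. For any $m\in\mathbb{Z}^+$ and any $0<\varepsilon\le\frac12$, the language $C(m)$ can be recognized with one-sided error $\varepsilon$ by a 2QCFA $\mathcal{A}(m,\varepsilon)$ with 2 quantum basis states and a constant number of classical states (depending neither on $m$ nor on $\varepsilon$), in polynomial expected running time $O\!\left(\frac{1}{\varepsilon}m^2 n^4\right)$, where $n$ is the length of the input.
   Context: A 2QCFA (two-way finite automaton with quantum and classical states) is a 9-tuple $(Q,S,\Sigma,\Theta,\delta,|q_0\rangle,s_0,S_{acc},S_{rej})$, where $Q$ is a finite set of orthonormal quantum basis states spanning a Hilbert space $H(Q)$; $S$ is a finite set of classical states; $\Sigma$ is a finite input alphabet, and $\Sigma'$ is $\Sigma$ together with a left end-marker and a right end-marker; $|q_0\rangle\in Q$ is the initial quantum state; $s_0\in S$ is the initial classical state; $S_{acc},S_{rej}\subset S$ are disjoint sets of accepting and rejecting states. The quantum transition function $\Theta$ assigns to every pair $(s,\sigma)\in (S\setminus(S_{acc}\cup S_{rej}))\times\Sigma'$ either a unitary operation on $H(Q)$ or a projective measurement on $H(Q)$. The computation on $w\in\Sigma^*$ starts with $w$ between the end-markers on the tape, the head on the left end-marker, classical state $s_0$ and quantum state $|q_0\rangle$. In each step, with classical state $s$ and scanned symbol $\sigma$: if $\Theta(s,\sigma)$ is unitary, it is applied to the quantum state, and $\delta(s,\sigma)=(s',d)\in S\times\{-1,0,1\}$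 gives the new classical state $s'$ and head movement $d$; if $\Theta(s,\sigma)$ is a projective measurement $\{P_1,\dots,P_k\}$, then outcome $i$ occurs with probability $\|P_i|\psi\rangle\|^2$ (where $|\psi\rangle$ is the current quantum state), the quantum state becomes $P_i|\psi\rangle/\|P_i|\psi\rangle\|$, and $\delta(s,\sigma)(i)=(s',d)\in S\times\{-1,0,1\}$ gives the new classical state and head movement. The automaton halts and accepts (rejects) when it enters a state of $S_{acc}$ ($S_{rej}$). $\Pr[\mathcal{A}\text{ accepts }w]$ and $\Pr[\mathcal{A}\text{ rejects }w]$ are the total probabilities of ever halting in acceptance, respectively rejection. The running time is the number of steps until halting. The number of quantum basis states is $|Q|$, the number of classical states is $|S|$. $\mathcal{A}$ recognizes $L\subset\Sigma^*$ with one-sided error $\varepsilon$ if $\Pr[\mathcal{A}\text{ accepts }w]=1$ for all $w\in L$, and $\Pr[\mathcal{A}\text{ rejects }w]\ge 1-\varepsilon$ for all $w\in\Sigma^*\setminus L$. The constant in $O(\cdot)$ is absolute (independent of $m$, $\varepsilon$ and the input), and the bound is understood for inputs of length $n\ge 1$. *)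

theory Defs
  imports "HOL-Probability.Probability" "HOL-Library.Numeral_Type"
begin

text \<open>
  The set \<open>Q\<close> of quantum basis states is the finite index type \<open>'q\<close>: the space \<open>H(Q)\<close> is
  \<open>complex^'q\<close>, the basis state \<open>q\<close> is \<open>axis q 1\<close>, and \<open>card Q\<close> is \<open>CARD('q)\<close>.
\<close>

definition adjoint_mat :: "complex^'n^'m \<Rightarrow> complex^'m^'n" where
  "adjoint_mat M = (\<chi> i j. cnj (M $ j $ i))"

definition unitary_mat :: "complex^'q^'q \<Rightarrow> bool" where
  "unitary_mat U \<longleftrightarrow> adjoint_mat U ** U = mat 1 \<and> U ** adjoint_mat U = mat 1"

definition projective_measurement :: "(complex^'q^'q) list \<Rightarrow> bool" where
  "projective_measurement Ps \<longleftrightarrow>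
     (\<forall>P\<in>set Ps. adjoint_mat P = P \<and> P ** P = P) \<and>
     (\<forall>i<length Ps. \<forall>j<length Ps. i \<noteq> j \<longrightarrow> Ps ! i ** Ps ! j = 0) \<and>
     sum_list Ps = mat 1"

datatype 'q qop = Unitary "complex^'q^'q" | Measure "(complex^'q^'q) list"

datatype 'a tape_symbol = Left_End | Letter 'a | Right_End

text \<open>
  \<open>delta A s x i\<close> is the classical transition when the quantum operation \<open>theta A s x\<close> has
  outcome \<open>i\<close>, outcomes being numbered from 0.  For a unitary operation only the value at
  \<open>i = 0\<close> is used.  The fields \<open>theta\<close> and \<open>delta\<close> are total functions; only their values at
  non-halting states and tape symbols over the alphabet matter.
\<close>

record ('q, 's, 'a) qcfa =
  states :: "'s set"
  alphabet :: "'a set"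
  theta :: "'s \<Rightarrow> 'a tape_symbol \<Rightarrow> 'q qop"
  delta :: "'s \<Rightarrow> 'a tape_symbol \<Rightarrow> nat \<Rightarrow> 's \<times> int"
  qinit :: 'q
  sinit :: 's
  acc_states :: "'s set"
  rej_states :: "'s set"

definition quantum_states :: "('q::finite, 's, 'a) qcfa \<Rightarrow> 'q set" where
  "quantum_states A = UNIV"

definition halting_states :: "('q::finite, 's, 'a) qcfa \<Rightarrow> 's set" where
  "halting_states A = acc_states A \<union> rej_states A"

definition tape_symbols :: "('q::finite, 's, 'a) qcfa \<Rightarrow> 'a tape_symbol set" where
  "tape_symbols A = {Left_End, Right_End} \<union> Letter ` alphabet A"

text \<open>The head may not leave the tape: not to the left of the left end-marker and not to the
  right of the right end-marker.\<close>

definition valid_move ::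
    "('q::finite, 's, 'a) qcfa \<Rightarrow> 'a tape_symbol \<Rightarrow> 's \<times> int \<Rightarrow> bool" where
  "valid_move A x m \<longleftrightarrow>
     fst m \<in> states A \<and> snd m \<in> {-1, 0, 1} \<and>
     (x = Left_End \<longrightarrow> snd m \<noteq> -1) \<and> (x = Right_End \<longrightarrow> snd m \<noteq> 1)"

definition is_2qcfa :: "('q::finite, 's, 'a) qcfa \<Rightarrow> bool" where
  "is_2qcfa A \<longleftrightarrow>
     finite (states A) \<and> finite (alphabet A) \<and> sinit A \<in> states A \<and>
     acc_states A \<subseteq> states A \<and> rej_states A \<subseteq> states A \<and>
     acc_states A \<inter> rej_states A = {} \<and>
     (\<forall>s \<in> states A - halting_states A. \<forall>x \<in> tape_symbols A.
        case theta A s x of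
          Unitary U \<Rightarrow> unitary_mat U \<and> valid_move A x (delta A s x 0)
        | Measure Ps \<Rightarrow> projective_measurement Ps \<and>
            (\<forall>i<length Ps. valid_move A x (delta A s x i)))"

text \<open>A configuration: classical state, head position (0 is the left end-marker), quantum state.\<close>

type_synonym ('q, 's) config = "'s \<times> nat \<times> (complex^'q)"

definition tape :: "'a list \<Rightarrow> nat \<Rightarrow> 'a tape_symbol" where
  "tape w i = (Left_End # map Letter w @ [Right_End]) ! i"

definition initial :: "('q::finite, 's, 'a) qcfa \<Rightarrow> ('q, 's) config" where
  "initial A = (sinit A, 0, axis (qinit A) 1)"

definition move :: "'s \<times> int \<Rightarrow> nat \<Rightarrow> complex^'q \<Rightarrow> ('q::finite, 's) config" where
  "move m i \<psi> = (fst m, nat (int i + snd m), \<psi>)"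

text \<open>The function given to \<open>embed_pmf\<close> is a probability mass function whenever \<open>\<psi>\<close> is a unit
  vector and \<open>Ps\<close> is a projective measurement, see \<open>pmf_outcome\<close> below.\<close>

definition outcome :: "(complex^'q) \<Rightarrow> (complex^'q^'q) list \<Rightarrow> nat pmf" where
  "outcome \<psi> Ps = embed_pmf (\<lambda>i. if i < length Ps then (norm (Ps ! i *v \<psi>))\<^sup>2 else 0)"

definition step ::
    "('q::finite, 's, 'a) qcfa \<Rightarrow> 'a list \<Rightarrow> ('q, 's) config \<Rightarrow> ('q, 's) config pmf" where
  "step A w = (\<lambda>(s, i, \<psi>). let x = tape w i in
     case theta A s x of
       Unitary U \<Rightarrow> return_pmf (move (delta A s x 0) i (U *v \<psi>))
     | Measure Ps \<Rightarrow>
         map_pmf (\<lambda>k. move (delta A s x k) i (Ps ! k *v \<psi> /\<^sub>R norm (Ps ! k *v \<psi>)))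
           (outcome \<psi> Ps))"

text \<open>
  The subdistribution of the configuration after exactly \<open>t\<close> steps; computations that have
  halted before step \<open>t\<close> carry no mass in it.  The mass of the halting configurations is therefore
  the probability of halting after exactly \<open>t\<close> steps.
\<close>

primrec run ::
    "('q::finite, 's, 'a) qcfa \<Rightarrow> 'a list \<Rightarrow> nat \<Rightarrow> ('q, 's) config spmf" where
  "run A w 0 = return_spmf (initial A)"
| "run A w (Suc t) = bind_spmf (run A w t)
     (\<lambda>c. if fst c \<in> halting_states A then return_pmf None else spmf_of_pmf (step A w c))"

definition halt_prob_at ::
    "('q::finite, 's, 'a) qcfa \<Rightarrow> 'a list \<Rightarrow> 's set \<Rightarrow> nat \<Rightarrow> ennreal" where
  "halt_prob_at A w H t = emeasure (measure_spmf (run A w t)) {c. fst c \<in> H}"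

definition accept_prob :: "('q::finite, 's, 'a) qcfa \<Rightarrow> 'a list \<Rightarrow> ennreal" where
  "accept_prob A w = (\<Sum>t. halt_prob_at A w (acc_states A) t)"

definition reject_prob :: "('q::finite, 's, 'a) qcfa \<Rightarrow> 'a list \<Rightarrow> ennreal" where
  "reject_prob A w = (\<Sum>t. halt_prob_at A w (rej_states A) t)"

text \<open>The expectation of the number of steps until halting, a random variable with values in the
  natural numbers and \<open>\<infinity>\<close>.  The second summand accounts for computations that never halt.\<close>

definition expected_time :: "('q::finite, 's, 'a) qcfa \<Rightarrow> 'a list \<Rightarrow> ennreal" where
  "expected_time A w =
     (\<Sum>t. of_nat t * halt_prob_at A w (halting_states A) t) +
     \<infinity> * (1 - (\<Sum>t. halt_prob_at A w (halting_states A) t))"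

definition recognizes_one_sided ::
    "('q::finite, 's, 'a) qcfa \<Rightarrow> 'a list set \<Rightarrow> real \<Rightarrow> bool" where
  "recognizes_one_sided A L \<epsilon> \<longleftrightarrow>
     L \<subseteq> lists (alphabet A) \<and>
     (\<forall>w\<in>L. accept_prob A w = 1) \<and>
     (\<forall>w\<in>lists (alphabet A) - L. reject_prob A w \<ge> ennreal (1 - \<epsilon>))"

definition words_of_length :: "'a set \<Rightarrow> nat \<Rightarrow> 'a list set" where
  "words_of_length \<Sigma> m = {w \<in> lists \<Sigma>. length w = m}"

lemma inner_matrix_vector_mult:
  fixes M :: "complex^'q^'q"
  shows "(M *v x) \<bullet> y = x \<bullet> (adjoint_mat M *v y)"
proof -
  have "(M *v x) \<bullet> y = (\<Sum>i\<in>UNIV. \<Sum>j\<in>UNIV. Re (M $ i $ j * x $ j * cnj (y $ i)))"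
    by (simp add: inner_vec_def matrix_vector_mult_def inner_complex_def Re_sum Im_sum
        sum_distrib_left sum.distrib sum_subtractf algebra_simps)
  also have "\<dots> = (\<Sum>j\<in>UNIV. \<Sum>i\<in>UNIV. Re (M $ i $ j * x $ j * cnj (y $ i)))"
    by (rule sum.swap)
  also have "\<dots> = x \<bullet> (adjoint_mat M *v y)"
    by (simp add: inner_vec_def matrix_vector_mult_def inner_complex_def adjoint_mat_def
        sum_distrib_left sum.distrib[symmetric] algebra_simps)
  finally show ?thesis .
qed

lemma sum_outcome_probs:
  fixes \<psi> :: "complex^'q"
  assumes "projective_measurement Ps"
  shows "(\<Sum>i<length Ps. (norm (Ps ! i *v \<psi>))\<^sup>2) = (norm \<psi>)\<^sup>2"
proof -
  have "(norm (Ps ! i *v \<psi>))\<^sup>2 = \<psi> \<bullet> (Ps ! i *v \<psi>)" if "i < length Ps" for i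
    using assms that
    by (simp add: power2_norm_eq_inner inner_matrix_vector_mult matrix_vector_mul_assoc
        projective_measurement_def)
  hence "(\<Sum>i<length Ps. (norm (Ps ! i *v \<psi>))\<^sup>2) = \<psi> \<bullet> (\<Sum>i<length Ps. Ps ! i *v \<psi>)"
    by (simp add: inner_sum_right)
  also have "(\<Sum>i<length Ps. Ps ! i *v \<psi>) = sum_list Ps *v \<psi>"
  proof (induction Ps)
    case (Cons P Ps)
    thus ?case
      by (simp add: sum.lessThan_Suc_shift matrix_vector_mult_add_rdistrib del: sum.lessThan_Suc)
  qed simp
  finally show ?thesis
    using assms by (simp add: projective_measurement_def power2_norm_eq_inner)
qed

lemma pmf_outcome:
  assumes "projective_measurement Ps" "norm \<psi> = 1"
  shows "pmf (outcome \<psi> Ps) i = (if i < length Ps then (norm (Ps ! i *v \<psi>))\<^sup>2 else 0)"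
  unfolding outcome_def
proof (rule pmf_embed_pmf)
  let ?f = "\<lambda>i. if i < length Ps then (norm (Ps ! i *v \<psi>))\<^sup>2 else 0"
  have "(\<integral>\<^sup>+ i. ennreal (?f i) \<partial>count_space UNIV) = (\<Sum>i<length Ps. ennreal (?f i))"
    by (rule nn_integral_count_space') auto
  also have "\<dots> = ennreal (\<Sum>i<length Ps. (norm (Ps ! i *v \<psi>))\<^sup>2)"
    by (subst sum_ennreal[symmetric]) auto
  finally show "(\<integral>\<^sup>+ i. ennreal (?f i) \<partial>count_space UNIV) = 1"
    using sum_outcome_probs[OF assms(1), of \<psi>] assms(2) by simp
qed auto

end

theory Submission
  imports Defs
begin

text \<open>
  The automaton works in rounds, each started at the left end-marker in the quantum state \<open>|0>\<close>.
  It rotates the quantum state by \<open>-m \<surd>2 \<pi>\<close>, then by \<open>\<surd>2 \<pi>\<close> on each letter, measures at the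
  right end-marker and rejects on outcome 1.  This never happens if \<open>n = m\<close>; otherwise it happens with
  probability \<open>sin\<^sup>2 ((n - m) \<surd>2 \<pi>) \<ge> 1 / (16 (n - m)\<^sup>2)\<close>, because \<open>\<surd>2\<close> is badly approximable.
  If the round survives, two fair random walks of the head, driven by measurements of the qubit, run
  across the tape: one from position \<open>n\<close> which has to reach 0 before \<open>n + 1\<close>, then one from position 1
  which has to reach \<open>n + 1\<close> before 0.  Both succeed with probability \<open>1 / (n + 1)\<^sup>2\<close>, and then a
  quantum coin accepts with probability \<open>\<epsilon> / (16 m\<^sup>2)\<close>.  Since \<open>|n - m| \<le> m (n + 1)\<close>, a round for
  \<open>n \<noteq> m\<close> accepts with probability at most \<open>\<epsilon>\<close> times that of rejecting.  All probabilities and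
  expectations are bounded by explicit potential functions of the classical state and head position.
\<close>

subsection \<open>Potential functions for 2QCFA runs\<close>

lemma nn_integral_bind_spmf:
  "(\<integral>\<^sup>+ x. f x \<partial>measure_spmf (bind_spmf p g)) = (\<integral>\<^sup>+ x. \<integral>\<^sup>+ y. f y \<partial>measure_spmf (g x) \<partial>measure_spmf p)"
  unfolding measure_spmf_bind o_def
  by (subst nn_integral_bind[where B = "count_space UNIV"])
    (auto simp: space_subprob_algebra subprob_space_measure_spmf)

definition invariant ::
    "('q::finite, 's, 'a) qcfa \<Rightarrow> 'a list \<Rightarrow> ('q, 's) config set \<Rightarrow> bool" where
  "invariant A w I \<longleftrightarrow> initial A \<in> I \<and>
     (\<forall>c\<in>I. fst c \<notin> halting_states A \<longrightarrow> set_pmf (step A w c) \<subseteq> I)"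

lemma set_spmf_run_subset:
  assumes "invariant A w I"
  shows "set_spmf (run A w t) \<subseteq> I"
proof (induction t)
  case 0
  thus ?case using assms by (simp add: invariant_def)
next
  case (Suc t)
  have "set_spmf (if fst c \<in> halting_states A then return_pmf None else spmf_of_pmf (step A w c)) \<subseteq> I"
    if "c \<in> I" for c
    using assms that by (simp add: invariant_def)
  thus ?case using Suc by (fastforce simp: set_bind_spmf)
qed

text \<open>Foster--Lyapunov: if a potential \<open>V\<close> pays for the reward \<open>r\<close> of each step out of its
  expected decrease, then it bounds the total expected reward.\<close>

lemma suminf_reward_le_potential:
  assumes inv: "invariant A w I"
    and run: "\<And>c. c \<in> I \<Longrightarrow> fst c \<notin> halting_states A \<Longrightarrow>
                 r c + (\<integral>\<^sup>+ c'. V c' \<partial>measure_pmf (step A w c)) \<le> V c"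
    and halt: "\<And>c. c \<in> I \<Longrightarrow> fst c \<in> halting_states A \<Longrightarrow> r c \<le> V c"
  shows "(\<Sum>t. \<integral>\<^sup>+ c. r c \<partial>measure_spmf (run A w t)) \<le> (V (initial A) :: ennreal)"
proof -
  let ?E = "\<lambda>t f. \<integral>\<^sup>+ c. f c \<partial>measure_spmf (run A w t)"
  let ?g = "\<lambda>c. if fst c \<in> halting_states A then return_pmf None else spmf_of_pmf (step A w c)"
  have step: "?E t r + ?E (Suc t) V \<le> ?E t V" for t
  proof -
    have "?E t r + ?E (Suc t) V = ?E t (\<lambda>c. r c + (\<integral>\<^sup>+ c'. V c' \<partial>measure_spmf (?g c)))"
      by (simp add: nn_integral_bind_spmf nn_integral_add)
    \<comment> \<open>A halted configuration passes on no mass, so its successor integral is 0 and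
      \<open>halt\<close> suffices there.\<close>
    also have "\<dots> \<le> ?E t V"
      using set_spmf_run_subset[OF inv, of t] run halt
      by (intro nn_integral_mono_AE) auto
    finally show ?thesis .
  qed
  have "(\<Sum>t<k. ?E t r) + ?E k V \<le> V (initial A)" for k
  proof (induction k)
    case 0
    thus ?case by (simp add: measure_spmf_return_spmf nn_integral_return)
  next
    case (Suc k)
    have "(\<Sum>t<Suc k. ?E t r) + ?E (Suc k) V = (\<Sum>t<k. ?E t r) + (?E k r + ?E (Suc k) V)"
      by (simp add: add.assoc)
    also have "\<dots> \<le> (\<Sum>t<k. ?E t r) + ?E k V"
      by (intro add_left_mono step)
    finally show ?case using Suc by (rule order_trans)
  qed
  hence "(\<Sum>t<k. ?E t r) \<le> V (initial A)" for k
    by (meson le_iff_add order_trans)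
  thus ?thesis
    by (intro suminf_le_const) auto
qed

section \<open>Tail sums of the halting time\<close>

text \<open>For the halting time T this is P(T > t). Its sum over \<open>t\<close> is a total reward
  of 1 per running configuration, within reach of the potential method.\<close>

definition running_prob_at :: "('q::finite, 's, 'a) qcfa \<Rightarrow> 'a list \<Rightarrow> nat \<Rightarrow> ennreal" where
  "running_prob_at A w t = emeasure (measure_spmf (run A w t)) {c. fst c \<notin> halting_states A}"

lemma running_prob_at_0:
  "running_prob_at A w 0 + halt_prob_at A w (halting_states A) 0 = 1"
  by (auto simp: running_prob_at_def halt_prob_at_def measure_spmf_return_spmf indicator_def)

lemma running_prob_at_Suc:
  "running_prob_at A w (Suc t) + halt_prob_at A w (halting_states A) (Suc t) = running_prob_at A w t"
proof -
  let ?M = "measure_spmf (run A w (Suc t))"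
  have "running_prob_at A w (Suc t) + halt_prob_at A w (halting_states A) (Suc t) =
      emeasure ?M ({c. fst c \<notin> halting_states A} \<union> {c. fst c \<in> halting_states A})"
    unfolding running_prob_at_def halt_prob_at_def by (rule plus_emeasure) auto
  also have "\<dots> = (\<integral>\<^sup>+ c. 1 \<partial>?M)"
    by (simp add: Un_def space_measure_spmf del: run.simps)
  also have "\<dots> = (\<integral>\<^sup>+ c. indicator {c. fst c \<notin> halting_states A} c \<partial>measure_spmf (run A w t))"
    unfolding run.simps nn_integral_bind_spmf
    by (intro nn_integral_cong) (auto simp: indicator_def)
  also have "\<dots> = running_prob_at A w t"
    by (simp add: running_prob_at_def)
  finally show ?thesis .
qed

text \<open>Tail-sum formula for E(T). A finite sum forces P(T > t) to tend to 0, so halting is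
  almost sure and the infinite summand of \<open>expected_time\<close> vanishes.\<close>

lemma
  assumes fin: "(\<Sum>t. running_prob_at A w t) < \<infinity>"
  shows suminf_halt_prob_at: "(\<Sum>t. halt_prob_at A w (halting_states A) t) = 1"
    and expected_time_le: "expected_time A w \<le> (\<Sum>t. running_prob_at A w t)"
proof -
  let ?u = "running_prob_at A w" and ?h = "halt_prob_at A w (halting_states A)"
  have sum_h: "(\<Sum>t<Suc k. ?h t) + ?u k = 1" for k
  proof (induction k)
    case 0
    thus ?case using running_prob_at_0[of A w] by (simp add: add.commute)
  next
    case (Suc k)
    thus ?case
      by (simp add: running_prob_at_Suc[of A w k, symmetric] ac_simps)
  qed
  have "?u \<longlonglongrightarrow> 0"
  proof -
    have "?u k \<noteq> \<infinity>" for k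
      using sum_h[of k] by (auto simp: top_add)
    hence eq: "?u = (\<lambda>k. ennreal (enn2real (?u k)))"
      by (simp add: fun_eq_iff ennreal_enn2real_if)
    have "summable (\<lambda>k. enn2real (?u k))"
      by (rule summable_suminf_not_top) (use fin eq in simp_all)
    hence "(\<lambda>k. enn2real (?u k)) \<longlonglongrightarrow> 0"
      by (rule summable_LIMSEQ_zero)
    hence "(\<lambda>k. ennreal (enn2real (?u k))) \<longlonglongrightarrow> ennreal 0"
      by (rule tendsto_ennrealI)
    thus ?thesis using eq by simp
  qed
  moreover have "(\<lambda>k. \<Sum>t<Suc k. ?h t) \<longlonglongrightarrow> (\<Sum>t. ?h t)"
    by (intro LIMSEQ_Suc summable_LIMSEQ) auto
  ultimately have "(\<lambda>k. (\<Sum>t<Suc k. ?h t) + ?u k) \<longlonglongrightarrow> (\<Sum>t. ?h t) + 0"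
    by (intro tendsto_add)
  hence "(\<lambda>k. 1) \<longlonglongrightarrow> (\<Sum>t. ?h t)"
    unfolding sum_h by simp
  thus sum1: "(\<Sum>t. ?h t) = 1"
    using LIMSEQ_unique tendsto_const by metis
  \<comment> \<open>Summation by parts; the boundary term \<open>of_nat k * ?u k\<close> makes the
    induction close and is dropped afterwards.\<close>
  have "(\<Sum>t<Suc k. of_nat t * ?h t) + of_nat k * ?u k \<le> (\<Sum>t<k. ?u t)" for k
  proof (induction k)
    case (Suc k)
    have "(\<Sum>t<Suc (Suc k). of_nat t * ?h t) + of_nat (Suc k) * ?u (Suc k) =
        (\<Sum>t<Suc k. of_nat t * ?h t) + of_nat (Suc k) * (?u (Suc k) + ?h (Suc k))"
      by (simp add: distrib_left add_ac del: of_nat_Suc)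
    also have "\<dots> = ((\<Sum>t<Suc k. of_nat t * ?h t) + of_nat k * ?u k) + ?u k"
      unfolding running_prob_at_Suc by (simp add: algebra_simps)
    also have "\<dots> \<le> (\<Sum>t<k. ?u t) + ?u k"
      by (intro add_right_mono Suc.IH)
    finally show ?case by simp
  qed simp
  hence "(\<Sum>t<Suc k. of_nat t * ?h t) \<le> (\<Sum>t<k. ?u t)" for k
    by (meson le_iff_add order_trans)
  also have "(\<Sum>t<k. ?u t) \<le> (\<Sum>t. ?u t)" for k
    by (intro sum_le_suminf) auto
  finally have le: "(\<Sum>t<Suc k. of_nat t * ?h t) \<le> (\<Sum>t. ?u t)" for k .
  have "(\<Sum>t<k. of_nat t * ?h t) \<le> (\<Sum>t. ?u t)" for k
    by (cases k) (use le in auto)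
  hence "(\<Sum>t. of_nat t * ?h t) \<le> (\<Sum>t. ?u t)"
    by (intro suminf_le_const) auto
  thus "expected_time A w \<le> (\<Sum>t. ?u t)"
    by (simp add: expected_time_def sum1)
qed

lemma halt_prob_at_halting_states:
  assumes "acc_states A \<inter> rej_states A = {}"
  shows "halt_prob_at A w (halting_states A) t =
    halt_prob_at A w (acc_states A) t + halt_prob_at A w (rej_states A) t"
  unfolding halt_prob_at_def halting_states_def
  by (subst plus_emeasure) (use assms in \<open>auto intro!: arg_cong2[where f = emeasure]\<close>)

lemma accept_prob_plus_reject_prob:
  assumes "acc_states A \<inter> rej_states A = {}" "(\<Sum>t. running_prob_at A w t) < \<infinity>"
  shows "accept_prob A w + reject_prob A w = 1"
  using suminf_halt_prob_at[OF assms(2)] unfolding accept_prob_def reject_prob_def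
  by (simp add: suminf_add halt_prob_at_halting_states[OF assms(1)])

subsection \<open>Multiples of the angle \<open>\<surd>2 \<pi>\<close>\<close>

text \<open>The nonzero integer \<open>2 * d^2 - k^2\<close> factors as
  \<open>sqrt 2 * d - k\<close> times \<open>sqrt 2 * d + k\<close>, and the second factor is at
  most \<open>4 * d\<close> in absolute value.\<close>

lemma sqrt2_mult_diff_int_ge:
  fixes d :: nat and k :: int
  assumes "d \<ge> 1" "\<bar>sqrt 2 * d - k\<bar> \<le> 1/2"
  shows "1 / (4 * d) \<le> \<bar>sqrt 2 * d - k\<bar>"
proof -
  have s: "sqrt 2 \<le> 3/2" by (rule real_le_lsqrt) (auto simp: power2_eq_square)
  have ne: "k^2 \<noteq> 2 * (int d)^2"
  proof
    assume eq: "k^2 = 2 * (int d)^2"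
    hence "k \<noteq> 0" using assms(1) by auto
    \<comment> \<open>Parity argument: 2 has even multiplicity in \<open>k^2\<close> but odd
      multiplicity in \<open>2 * d^2\<close>.\<close>
    hence "multiplicity 2 (k^2) = 2 * multiplicity 2 k"
      by (subst prime_elem_multiplicity_power_distrib) auto
    moreover have "multiplicity 2 (2 * (int d)^2) = 1 + 2 * multiplicity 2 (int d)"
      using assms(1) by (subst prime_elem_multiplicity_mult_distrib)
        (auto simp: prime_elem_multiplicity_power_distrib)
    moreover have "multiplicity 2 (k^2) = multiplicity 2 (2 * (int d)^2)"
      using eq by (rule arg_cong)
    ultimately have "2 * multiplicity 2 k = 1 + 2 * multiplicity 2 (int d)"
      by linarith
    hence "even (1 + 2 * multiplicity 2 (int d))" by (rule dvdI[OF sym])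
    thus False by simp
  qed
  have "1 \<le> real d" using assms(1) by simp
  moreover have "1 \<le> sqrt 2" by simp
  ultimately have "1 \<le> sqrt 2 * d" using mult_mono[of 1 "sqrt 2" 1 "real d"] by simp
  moreover have "sqrt 2 * d \<le> 3/2 * d" by (intro mult_right_mono s) simp
  ultimately have k: "\<bar>sqrt 2 * d + k\<bar> \<le> 4 * d"
    using assms(2) \<open>1 \<le> real d\<close> by linarith
  have "1 \<le> \<bar>2 * (int d)^2 - k^2\<bar>" using ne by linarith
  hence "real_of_int 1 \<le> of_int \<bar>2 * (int d)^2 - k^2\<bar>" by (simp only: of_int_le_iff)
  hence "1 \<le> \<bar>2 * (real d)^2 - (real_of_int k)^2\<bar>" by simp
  also have "2 * (real d)^2 - (real_of_int k)^2 = (sqrt 2 * d - k) * (sqrt 2 * d + k)"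
    by (simp add: algebra_simps power2_eq_square)
  also have "\<bar>\<dots>\<bar> \<le> \<bar>sqrt 2 * d - k\<bar> * (4 * d)"
    unfolding abs_mult by (intro mult_left_mono k) simp
  finally show ?thesis using assms(1) by (simp add: field_simps)
qed

text \<open>The cosine stays above \<open>sqrt 2 / 2\<close> only up to \<open>pi/4\<close>, so the
  mean value theorem is applied at \<open>z = x/2\<close> and followed by
  \<open>sin x = 2 * sin z * cos z\<close>.\<close>

lemma sin_ge_half:
  fixes x :: real
  assumes "0 \<le> x" "x \<le> pi/2"
  shows "x/2 \<le> sin x"
proof (cases "x = 0")
  case False
  define z where "z = x/2"
  have z: "0 < z" "z \<le> pi/4" using assms False by (auto simp: z_def)
  have c: "sqrt 2 / 2 \<le> cos y" if "0 \<le> y" "y \<le> pi/4" for y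
    using that cos_monotone_0_pi_le[of y "pi/4"] by (simp add: cos_45)
  obtain y where y: "0 < y" "y < z" "sin z - sin 0 = (z - 0) * cos y"
    using MVT2[of 0 z sin cos] z by auto
  have "z * (sqrt 2 / 2) \<le> sin z"
    using y z c[of y] by (auto intro!: mult_left_mono)
  hence "(z * (sqrt 2 / 2)) * (sqrt 2 / 2) \<le> sin z * cos z"
    using c[of z] z by (intro mult_mono) (auto intro!: sin_ge_zero)
  also have "(z * (sqrt 2 / 2)) * (sqrt 2 / 2) = z / 2"
    using real_sqrt_mult_self[of 2] by (simp add: algebra_simps)
  finally show ?thesis using sin_double[of z] by (simp add: z_def)
qed simp

text \<open>Up to sign and modulo pi the angle is pi times the distance \<open>y\<close> from
  \<open>sqrt 2 * \<bar>d\<bar>\<close> to the nearest integer. That distance is at least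
  \<open>1 / (4 * \<bar>d\<bar>)\<close>, and
  \<open>sin (pi * y) \<ge> pi * y / 2 \<ge> y\<close>.\<close>

lemma sin_squared_sqrt2_pi_ge:
  fixes d :: int
  assumes "d \<noteq> 0"
  shows "1 / (16 * (real_of_int d)\<^sup>2) \<le> (sin (d * (sqrt 2 * pi)))\<^sup>2"
proof -
  define e where "e = nat \<bar>d\<bar>"
  have e: "e \<ge> 1" "\<bar>real_of_int d\<bar> = real e" using assms by (auto simp: e_def)
  define k where "k = round (sqrt 2 * e)"
  define y where "y = sqrt 2 * e - k"
  have y: "\<bar>y\<bar> \<le> 1/2"
    using of_int_round_abs_le[of "sqrt 2 * e"] by (simp add: y_def k_def abs_minus_commute)
  have "1 / (4 * e) \<le> \<bar>y\<bar>"
    using sqrt2_mult_diff_int_ge[of e k] e y by (simp add: y_def)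
  also have "\<dots> \<le> pi * \<bar>y\<bar> / 2"
    using pi_gt3 mult_right_mono[of 2 pi "\<bar>y\<bar>"] by simp
  also have "\<dots> \<le> sin (pi * \<bar>y\<bar>)"
    using mult_left_mono[OF y, of pi] by (intro sin_ge_half) simp_all
  finally have "(1 / (4 * e))\<^sup>2 \<le> (sin (pi * \<bar>y\<bar>))\<^sup>2"
    by (intro power_mono) auto
  also have "(sin (pi * \<bar>y\<bar>))\<^sup>2 = (sin (pi * y))\<^sup>2"
    by (simp add: abs_if)
  also have "pi * y = e * (sqrt 2 * pi) - k * pi"
    by (simp add: y_def algebra_simps)
  also have "(sin \<dots>)\<^sup>2 = (sin (e * (sqrt 2 * pi)))\<^sup>2"
  proof -
    have "sin (k * pi) = 0" by (simp add: sin_times_pi_eq_0)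
    moreover from this have "(cos (k * pi))\<^sup>2 = 1" by (simp add: cos_squared_eq)
    ultimately show ?thesis by (simp add: sin_diff power_mult_distrib)
  qed
  also have "\<dots> = (sin (d * (sqrt 2 * pi)))\<^sup>2"
    unfolding e(2)[symmetric] by (simp add: abs_if)
  also have "(1 / (4 * e))\<^sup>2 = 1 / (16 * (real_of_int d)\<^sup>2)"
    using arg_cong[OF e(2), of "\<lambda>x. x\<^sup>2"] by (simp add: power_divide power_mult_distrib)
  finally show ?thesis .
qed

subsection \<open>Quantum states with real amplitudes\<close>

text \<open>All states that occur are real unit vectors; in terms of the angle, rotations are
  additions and normalisation is automatic.\<close>

definition ray :: "real \<Rightarrow> complex^2" where
  "ray \<alpha> = vector [complex_of_real (cos \<alpha>), complex_of_real (sin \<alpha>)]"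

definition rotation :: "real \<Rightarrow> complex^2^2" where
  "rotation \<beta> = vector
     [vector [complex_of_real (cos \<beta>), - complex_of_real (sin \<beta>)],
      vector [complex_of_real (sin \<beta>), complex_of_real (cos \<beta>)]]"

definition basis_measurement :: "(complex^2^2) list" where
  "basis_measurement =
     [vector [vector [1, 0], vector [0, 0]], vector [vector [0, 0], vector [0, 1]]]"

lemma ray_0: "ray 0 = axis 1 1"
  by (simp add: ray_def vec_eq_iff forall_2 axis_def)

lemma norm_ray [simp]: "norm (ray \<alpha>) = 1"
  by (simp add: norm_vec_def L2_set_def sum_2 ray_def)

lemma rotation_mult_ray: "rotation \<beta> *v ray \<alpha> = ray (\<alpha> + \<beta>)"
  by (simp add: ray_def rotation_def vec_eq_iff forall_2 matrix_vector_mult_def sum_2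
      cos_add sin_add algebra_simps)

lemma unitary_rotation: "unitary_mat (rotation \<beta>)"
proof -
  have "complex_of_real (cos \<beta>) * cos \<beta> + complex_of_real (sin \<beta>) * sin \<beta> = 1"
    by (metis of_real_1 of_real_add of_real_mult power2_eq_square sin_cos_squared_add2)
  thus ?thesis
    by (simp add: unitary_mat_def adjoint_mat_def rotation_def vec_eq_iff forall_2
        matrix_matrix_mult_def sum_2 mat_def algebra_simps)
qed

lemma length_basis_measurement [simp]: "length basis_measurement = 2"
  by (simp add: basis_measurement_def)

lemma projective_basis_measurement: "projective_measurement basis_measurement"
  by (auto simp: projective_measurement_def basis_measurement_def adjoint_mat_def vec_eq_iff
      forall_2 matrix_matrix_mult_def sum_2 mat_def less_Suc_eq numeral_2_eq_2)

lemma norm_basis_measurement_ray: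
  "norm (basis_measurement ! 0 *v ray \<alpha>) = \<bar>cos \<alpha>\<bar>"
  "norm (basis_measurement ! 1 *v ray \<alpha>) = \<bar>sin \<alpha>\<bar>"
  by (simp_all add: basis_measurement_def ray_def norm_vec_def L2_set_def sum_2
      matrix_vector_mult_def)

text \<open>The state after the measurement is |0> or -|0>; \<open>sin \<beta> = 0\<close> covers
  both, as no later probability depends on the sign.\<close>

lemma basis_measurement_ray_0:
  assumes "cos \<alpha> \<noteq> 0"
  shows "\<exists>\<beta>. basis_measurement ! 0 *v ray \<alpha> /\<^sub>R norm (basis_measurement ! 0 *v ray \<alpha>) = ray \<beta> \<and> sin \<beta> = 0"
  unfolding norm_basis_measurement_ray
  by (rule exI[of _ "if cos \<alpha> > 0 then 0 else pi"])
    (use assms in \<open>auto simp: basis_measurement_def ray_def vec_eq_iff forall_2 sum_2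
      matrix_vector_mult_def scaleR_conv_of_real[where 'a = complex] simp flip: of_real_mult\<close>)

lemma basis_measurement_ray_1:
  assumes "sin \<alpha> \<noteq> 0"
  shows "\<exists>\<beta>. basis_measurement ! 1 *v ray \<alpha> /\<^sub>R norm (basis_measurement ! 1 *v ray \<alpha>) = ray \<beta> \<and> cos \<beta> = 0"
  unfolding norm_basis_measurement_ray
  by (rule exI[of _ "if sin \<alpha> > 0 then pi/2 else -pi/2"])
    (use assms in \<open>auto simp: basis_measurement_def ray_def vec_eq_iff forall_2 sum_2
      matrix_vector_mult_def scaleR_conv_of_real[where 'a = complex] simp flip: of_real_mult\<close>)

lemma step_rotation:
  assumes "theta A s (tape w i) = Unitary (rotation \<beta>)"
  shows "step A w (s, i, ray \<alpha>) = return_pmf (move (delta A s (tape w i) 0) i (ray (\<alpha> + \<beta>)))"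
  using assms by (simp add: step_def rotation_mult_ray)

lemma pmf_outcome_ray:
  "pmf (outcome (ray \<alpha>) basis_measurement) k =
     (if k = 0 then (cos \<alpha>)\<^sup>2 else if k = 1 then (sin \<alpha>)\<^sup>2 else 0)"
  using norm_basis_measurement_ray
  by (auto simp: pmf_outcome[OF projective_basis_measurement] less_2_cases_iff)

lemma set_pmf_outcome_ray:
  "k \<in> set_pmf (outcome (ray \<alpha>) basis_measurement) \<longleftrightarrow> k = 0 \<and> cos \<alpha> \<noteq> 0 \<or> k = 1 \<and> sin \<alpha> \<noteq> 0"
  by (auto simp: set_pmf_iff pmf_outcome_ray)

lemma set_pmf_step_measure:
  assumes "theta A s (tape w i) = Measure basis_measurement"
    and "c \<in> set_pmf (step A w (s, i, ray \<alpha>))"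
  obtains (0) \<beta> where "c = move (delta A s (tape w i) 0) i (ray \<beta>)" "cos \<alpha> \<noteq> 0" "sin \<beta> = 0"
    | (1) \<beta> where "c = move (delta A s (tape w i) 1) i (ray \<beta>)" "sin \<alpha> \<noteq> 0" "cos \<beta> = 0"
proof -
  from assms obtain k where k: "k \<in> set_pmf (outcome (ray \<alpha>) basis_measurement)"
    "c = move (delta A s (tape w i) k) i
      (basis_measurement ! k *v ray \<alpha> /\<^sub>R norm (basis_measurement ! k *v ray \<alpha>))"
    by (auto simp: step_def)
  from k(1) consider "k = 0" "cos \<alpha> \<noteq> 0" | "k = 1" "sin \<alpha> \<noteq> 0"
    by (auto simp: set_pmf_outcome_ray)
  thus thesis
  proof cases
    case 1
    thus thesis using k(2) basis_measurement_ray_0[of \<alpha>] that(1) by metis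
  next
    case 2
    thus thesis using k(2) basis_measurement_ray_1[of \<alpha>] that(2) by metis
  qed
qed

text \<open>Potentials will depend on classical state and head position only, so the outcomes enter
  just through their weights.\<close>

lemma nn_integral_step_measure:
  assumes "theta A s (tape w i) = Measure basis_measurement"
    and delta: "delta A s (tape w i) 0 = (s0, d0)" "delta A s (tape w i) 1 = (s1, d1)"
  shows "(\<integral>\<^sup>+ c. f (fst c) (fst (snd c)) \<partial>measure_pmf (step A w (s, i, ray \<alpha>))) =
    ennreal ((cos \<alpha>)\<^sup>2) * f s0 (nat (int i + d0)) + ennreal ((sin \<alpha>)\<^sup>2) * f s1 (nat (int i + d1))"
proof -
  let ?M = "measure_pmf (outcome (ray \<alpha>) basis_measurement)"
  let ?g = "\<lambda>k. f (fst (delta A s (tape w i) k)) (nat (int i + snd (delta A s (tape w i) k)))"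
  have "(\<integral>\<^sup>+ c. f (fst c) (fst (snd c)) \<partial>measure_pmf (step A w (s, i, ray \<alpha>))) = (\<integral>\<^sup>+ k. ?g k \<partial>?M)"
    using assms(1) by (simp add: step_def move_def Let_def)
  also have "\<dots> = (\<Sum>k\<in>{0, 1}. ?g k * ennreal (pmf (outcome (ray \<alpha>) basis_measurement) k))"
    by (rule nn_integral_measure_pmf_support) (auto simp: set_pmf_outcome_ray)
  also have "\<dots> = ennreal ((cos \<alpha>)\<^sup>2) * f s0 (nat (int i + d0)) +
      ennreal ((sin \<alpha>)\<^sup>2) * f s1 (nat (int i + d1))"
    using delta by (simp add: pmf_outcome_ray mult.commute)
  finally show ?thesis .
qed

subsection \<open>The automaton\<close>

text \<open>Each measuring state is the successor of its walk state, whence \<open>s - 1\<close> in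
  \<open>move_of\<close> and \<open>Suc s\<close> later. \<open>ret\<close> brings the head back to
  the left end, \<open>sweep\<close> reads the word, \<open>coin\<close> decides on
  acceptance.\<close>

abbreviation (input) "ret \<equiv> 0 :: nat"
abbreviation (input) "sweep \<equiv> 1 :: nat"
abbreviation (input) "walk1 \<equiv> 2 :: nat"
abbreviation (input) "meas1 \<equiv> 3 :: nat"
abbreviation (input) "walk2 \<equiv> 4 :: nat"
abbreviation (input) "meas2 \<equiv> 5 :: nat"
abbreviation (input) "coin \<equiv> 6 :: nat"
abbreviation (input) "acc \<equiv> 7 :: nat"
abbreviation (input) "rej \<equiv> 8 :: nat"

text \<open>\<open>None\<close> stands for the measurement in the computational basis.\<close>

definition turn :: "nat \<Rightarrow> real \<Rightarrow> nat \<Rightarrow> 'a tape_symbol \<Rightarrow> real option" where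
  "turn m \<theta> s x =
    (if s = ret then Some (if x = Left_End then - m * (sqrt 2 * pi) else 0)
     else if s = sweep then (if x = Right_End then None else Some (sqrt 2 * pi))
     else if s = walk1 then Some (case x of Letter _ \<Rightarrow> pi/4 | _ \<Rightarrow> pi/2)
     else if s = walk2 then
       Some (case x of Left_End \<Rightarrow> 0 | Letter _ \<Rightarrow> pi/4 | Right_End \<Rightarrow> \<theta> - pi/2)
     else None)"

text \<open>Measuring states are entered on letters only; at an end-marker they stand still, so that
  \<open>valid_move\<close> holds for every symbol.\<close>

definition move_of :: "nat \<Rightarrow> 'a tape_symbol \<Rightarrow> nat \<Rightarrow> nat \<times> int" where
  "move_of s x k =
    (if s = ret then (if x = Left_End then (sweep, 1) else (ret, -1))
     else if s = sweep then
       (if x \<noteq> Right_End then (sweep, 1) else if k = 0 then (walk1, -1) else (rej, 0))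
     else if s = walk1 then
       (case x of Left_End \<Rightarrow> (walk2, 1) | Letter _ \<Rightarrow> (meas1, 0) | Right_End \<Rightarrow> (ret, 0))
     else if s = walk2 then
       (case x of Left_End \<Rightarrow> (ret, 0) | Letter _ \<Rightarrow> (meas2, 0) | Right_End \<Rightarrow> (coin, 0))
     else if s = meas1 \<or> s = meas2 then
       (case x of Letter _ \<Rightarrow> (s - 1, if k = 0 then -1 else 1) | _ \<Rightarrow> (s, 0))
     else (if k = 0 then ret else acc, 0))"

definition length_automaton :: "'a set \<Rightarrow> nat \<Rightarrow> real \<Rightarrow> (2, nat, 'a) qcfa" where
  "length_automaton \<Sigma> m \<theta> =
    \<lparr>states = {..8}, alphabet = \<Sigma>,
     theta = (\<lambda>s x. case turn m \<theta> s x of None \<Rightarrow> Measure basis_measurement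
                                       | Some \<beta> \<Rightarrow> Unitary (rotation \<beta>)),
     delta = move_of, qinit = 1, sinit = ret, acc_states = {acc}, rej_states = {rej}\<rparr>"

lemma length_automaton_simps [simp]:
  "states (length_automaton \<Sigma> m \<theta>) = {..8}"
  "alphabet (length_automaton \<Sigma> m \<theta>) = \<Sigma>"
  "delta (length_automaton \<Sigma> m \<theta>) = move_of"
  "acc_states (length_automaton \<Sigma> m \<theta>) = {acc}"
  "rej_states (length_automaton \<Sigma> m \<theta>) = {rej}"
  "halting_states (length_automaton \<Sigma> m \<theta>) = {acc, rej}"
  "theta (length_automaton \<Sigma> m \<theta>) s x = (case turn m \<theta> s x of
     None \<Rightarrow> Measure basis_measurement | Some \<beta> \<Rightarrow> Unitary (rotation \<beta>))"
  by (auto simp: length_automaton_def halting_states_def)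

lemma initial_length_automaton: "initial (length_automaton \<Sigma> m \<theta>) = (ret, 0, ray 0)"
  by (simp add: initial_def length_automaton_def ray_0)

lemma is_2qcfa_length_automaton:
  assumes "finite \<Sigma>"
  shows "is_2qcfa (length_automaton \<Sigma> m \<theta> :: (2, nat, 'a) qcfa)"
proof -
  let ?A = "length_automaton \<Sigma> m \<theta> :: (2, nat, 'a) qcfa"
  have "valid_move ?A x (move_of s x k)" if "s \<le> 8" for s x k
    using that by (auto simp: valid_move_def move_of_def split: tape_symbol.split)
  hence "case theta ?A s x of
          Unitary U \<Rightarrow> unitary_mat U \<and> valid_move ?A x (delta ?A s x 0)
        | Measure Ps \<Rightarrow> projective_measurement Ps \<and>
            (\<forall>i<length Ps. valid_move ?A x (delta ?A s x i))" if "s \<le> 8" for s x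
    using that
    by (auto simp: unitary_rotation projective_basis_measurement split: option.split)
  thus ?thesis
    using assms by (auto simp: is_2qcfa_def) (simp add: length_automaton_def)
qed

section \<open>The invariant tying the angle to classical state and head position\<close>

lemma move_simps:
  "move (s, 0) i \<psi> = (s, i, \<psi>)" "move (s, 1) i \<psi> = (s, Suc i, \<psi>)" "move (s, -1) i \<psi> = (s, i - 1, \<psi>)"
  by (simp_all add: move_def nat_diff_distrib nat_add_distrib)

lemma tape_simps:
  "tape w 0 = Left_End" "tape w (Suc (length w)) = Right_End"
  by (simp_all add: tape_def nth_append)

lemma tape_letter:
  assumes "1 \<le> i" "i \<le> length w"
  obtains a where "tape w i = Letter a"
  using assms that by (cases i) (auto simp: tape_def nth_append)

text \<open>A walk moves left on outcome 0 and right on outcome 1, so it reaches the left end-marker only in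
  a multiple of \<open>|0>\<close> and the right end-marker only in a multiple of \<open>|1>\<close>; no further classical
  memory is needed to restore \<open>|0>\<close>.\<close>

definition good :: "nat \<Rightarrow> real \<Rightarrow> nat \<Rightarrow> nat \<Rightarrow> nat \<Rightarrow> real \<Rightarrow> bool" where
  "good m \<theta> n s i \<alpha> \<longleftrightarrow> i \<le> Suc n \<and>
    (if s = ret then sin \<alpha> = 0
     else if s = sweep then 1 \<le> i \<and> sin (\<alpha> - (real i - 1 - real m) * (sqrt 2 * pi)) = 0
     else if s = walk1 \<or> s = walk2 then
       sin \<alpha> * cos \<alpha> = 0 \<and> (i = 0 \<longrightarrow> sin \<alpha> = 0) \<and> (i = Suc n \<longrightarrow> cos \<alpha> = 0)
     else if s = meas1 \<or> s = meas2 then 1 \<le> i \<and> i \<le> n \<and> (cos \<alpha>)\<^sup>2 = 1/2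
     else if s = coin then i = Suc n \<and> (sin \<alpha>)\<^sup>2 = (sin \<theta>)\<^sup>2
     else s = acc \<or> s = rej)"

lemma sin_diff_eq_0_imp:
  fixes x y :: real
  assumes "sin (x - y) = 0"
  shows "(sin x)\<^sup>2 = (sin y)\<^sup>2"
proof -
  have "sin x = sin ((x - y) + y)" by simp
  also have "\<dots> = cos (x - y) * sin y" unfolding sin_add using assms by simp
  finally show ?thesis using assms by (simp add: power_mult_distrib cos_squared_eq)
qed

text \<open>A basis state turned by \<open>pi/4\<close> is a fair coin, since
  \<open>(cos x - sin x)\<^sup>2 = 1 - 2 * sin x * cos x\<close>.\<close>

lemma cos_add_pi4_squared:
  fixes x :: real
  assumes "sin x * cos x = 0"
  shows "(cos (x + pi/4))\<^sup>2 = 1/2"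
proof -
  have "cos (x + pi/4) = (cos x - sin x) * (sqrt 2 / 2)"
    by (simp add: cos_add cos_45 sin_45 algebra_simps)
  hence "(cos (x + pi/4))\<^sup>2 = (cos x - sin x)\<^sup>2 / 2"
    by (simp only: power_mult_distrib power_divide) simp
  also have "(cos x - sin x)\<^sup>2 = 1"
    using assms sin_cos_squared_add3[of x] by (simp add: power2_eq_square algebra_simps)
  finally show ?thesis .
qed

text \<open>One case per kind of transition; both the invariance proof and the potential analysis
  split along it.\<close>

lemma good_cases:
  assumes "good m \<theta> (length w) s i \<alpha>" "s \<noteq> acc" "s \<noteq> rej"
  obtains
    (ret_left) "s = ret" "i = 0" "tape w i = Left_End" "sin \<alpha> = 0"
  | (ret) "s = ret" "1 \<le> i" "i \<le> Suc (length w)" "tape w i \<noteq> Left_End" "sin \<alpha> = 0"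
  | (sweep) a where "s = sweep" "1 \<le> i" "i \<le> length w" "tape w i = Letter a"
      "sin (\<alpha> - (real i - 1 - real m) * (sqrt 2 * pi)) = 0"
  | (sweep_right) "s = sweep" "i = Suc (length w)" "tape w i = Right_End"
      "(sin \<alpha>)\<^sup>2 = (sin ((real (length w) - real m) * (sqrt 2 * pi)))\<^sup>2"
  | (walk_left) "s = walk1 \<or> s = walk2" "i = 0" "tape w i = Left_End" "sin \<alpha> = 0"
  | (walk) a where "s = walk1 \<or> s = walk2" "1 \<le> i" "i \<le> length w" "tape w i = Letter a"
      "(cos (\<alpha> + pi/4))\<^sup>2 = 1/2"
  | (walk_right) "s = walk1 \<or> s = walk2" "i = Suc (length w)" "tape w i = Right_End" "cos \<alpha> = 0"
  | (meas) a where "s = meas1 \<or> s = meas2" "1 \<le> i" "i \<le> length w" "tape w i = Letter a"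
      "(cos \<alpha>)\<^sup>2 = 1/2" "(sin \<alpha>)\<^sup>2 = 1/2"
  | (coin) "s = coin" "i = Suc (length w)" "tape w i = Right_End" "(sin \<alpha>)\<^sup>2 = (sin \<theta>)\<^sup>2"
proof -
  have i: "i \<le> Suc (length w)" using assms(1) by (simp add: good_def)
  consider (left) "i = 0" "tape w i = Left_End"
    | (letter) a where "1 \<le> i" "i \<le> length w" "tape w i = Letter a"
    | (right) "i = Suc (length w)" "tape w i = Right_End"
    using i tape_letter[of i w] tape_simps[of w] by (metis le_SucE less_one linorder_not_le)
  thus thesis
  proof cases
    case left
    thus thesis using that(1,5) assms by (simp add: good_def split: if_splits)
  next
    case (letter a)
    thus thesis using that(2)[OF _ _ i] that(3,6,8) assms cos_add_pi4_squared[of \<alpha>]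
      by (auto simp add: good_def sin_squared_eq split: if_splits)
  next
    case right
    thus thesis using that(2)[OF _ _ i] that(4,7,9) assms sin_diff_eq_0_imp[of \<alpha>]
      by (auto simp add: good_def split: if_splits)
  qed
qed

lemma invariant_length_automaton:
  "invariant (length_automaton \<Sigma> m \<theta>) w
     {(s, i, ray \<alpha>) | s i \<alpha>. good m \<theta> (length w) s i \<alpha>}" (is "invariant ?A w ?I")
  unfolding invariant_def
proof (intro conjI ballI impI subsetI)
  show "initial ?A \<in> ?I"
    unfolding initial_length_automaton by (auto simp: good_def intro!: exI[of _ 0])
next
  fix c c' assume "c \<in> ?I" "fst c \<notin> halting_states ?A" and c': "c' \<in> set_pmf (step ?A w c)"
  then obtain s i \<alpha> where c: "c = (s, i, ray \<alpha>)" and g: "good m \<theta> (length w) s i \<alpha>"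
    and s: "s \<noteq> acc" "s \<noteq> rej"
    by auto
  have I: "(s', j, ray \<beta>) \<in> ?I" if "good m \<theta> (length w) s' j \<beta>" for s' j \<beta>
    using that by blast
  note rot = step_rotation[of ?A s w i, where \<alpha> = \<alpha>]
  note c' = c'[unfolded c]
  from g s show "c' \<in> ?I"
  proof (cases rule: good_cases)
    \<comment> \<open>With the head at \<open>i\<close>, \<open>i - 1\<close> letters have been
      read; entry at position 1 has angle \<open>- m * (sqrt 2 * pi)\<close> modulo pi.\<close>
    case ret_left
    thus ?thesis using c' rot[of "- m * (sqrt 2 * pi)"]
      by (auto simp: turn_def move_of_def move_simps good_def algebra_simps intro!: I)
  next
    case ret
    thus ?thesis using c' rot[of 0]
      by (auto simp: turn_def move_of_def move_simps good_def intro!: I)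
  next
    case (sweep a)
    thus ?thesis using c' rot[of "sqrt 2 * pi"]
      by (auto simp: turn_def move_of_def move_simps good_def algebra_simps intro!: I)
  next
    case sweep_right
    hence "theta ?A s (tape w i) = Measure basis_measurement" by (simp add: turn_def)
    from this c' show ?thesis
      by (cases rule: set_pmf_step_measure)
        (use sweep_right in \<open>auto simp: move_of_def move_simps good_def intro!: I\<close>)
  next
    case walk_left
    \<comment> \<open>For the empty word, position 1 is the right end-marker, where a multiple of
      |1> is demanded; the turn by \<open>pi/2\<close> supplies it.\<close>
    hence "good m \<theta> (length w) walk2 1 (\<alpha> + pi/2)" "good m \<theta> (length w) ret 0 \<alpha>"
      by (auto simp: good_def cos_add)
    from this[THEN I] show ?thesis
      using walk_left c' rot[of "if s = walk1 then pi/2 else 0"]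
      by (auto simp: turn_def move_of_def move_simps)
  next
    case (walk a)
    hence "good m \<theta> (length w) s' i (\<alpha> + pi/4)" if "s' = meas1 \<or> s' = meas2" for s'
      using that by (auto simp: good_def)
    from this[THEN I] show ?thesis
      using walk c' rot[of "pi/4"] by (auto simp: turn_def move_of_def move_simps)
  next
    case walk_right
    \<comment> \<open>The walk arrives with angle \<open>pi/2\<close> modulo pi, so this turn leaves
      \<theta> modulo pi for the coin.\<close>
    hence "(sin (\<alpha> + (\<theta> - pi/2)))\<^sup>2 = (sin \<theta>)\<^sup>2"
      using sin_cos_squared_add[of \<alpha>]
      by (simp add: sin_add cos_diff sin_diff power_mult_distrib)
    hence "good m \<theta> (length w) coin i (\<alpha> + (\<theta> - pi/2))" "good m \<theta> (length w) ret i (\<alpha> + pi/2)"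
      using walk_right by (auto simp: good_def sin_add)
    from this[THEN I] show ?thesis
      using walk_right c' rot[of "if s = walk1 then pi/2 else \<theta> - pi/2"]
      by (auto simp: turn_def move_of_def move_simps)
  next
    case (meas a)
    hence "theta ?A s (tape w i) = Measure basis_measurement" by (auto simp add: turn_def)
    from this c' show ?thesis
      by (cases rule: set_pmf_step_measure)
        (use meas in \<open>auto simp: move_of_def move_simps good_def intro!: I\<close>)
  next
    case coin
    hence "theta ?A s (tape w i) = Measure basis_measurement" by (simp add: turn_def)
    from this c' show ?thesis
      by (cases rule: set_pmf_step_measure)
        (use coin in \<open>auto simp: move_of_def move_simps good_def intro!: I\<close>)
  qed
qed

subsection \<open>Analysis of the automaton\<close>

text \<open>The invariant determines every outcome probability from state and position:
  \<open>p\<close> after a sweep, 1/2 in the walks, \<open>(sin \<theta>)\<^sup>2\<close> at the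
  coin. The potential condition thus splits into one real inequality per kind of transition.\<close>

lemma total_reward_length_automaton_le:
  fixes r :: "nat \<Rightarrow> real" and v :: "nat \<Rightarrow> nat \<Rightarrow> real"
  assumes r: "\<And>s. 0 \<le> r s" and v: "\<And>s i. i \<le> Suc n \<Longrightarrow> 0 \<le> v s i"
    and n: "n = length w"
    and p: "p = (sin ((real n - real m) * (sqrt 2 * pi)))\<^sup>2"
    and ret_left: "r ret + v sweep 1 \<le> v ret 0"
    and ret: "\<And>i. 1 \<le> i \<Longrightarrow> i \<le> Suc n \<Longrightarrow> r ret + v ret (i - 1) \<le> v ret i"
    and sweep: "\<And>i. 1 \<le> i \<Longrightarrow> i \<le> n \<Longrightarrow> r sweep + v sweep (Suc i) \<le> v sweep i"
    and sweep_right: "r sweep + (1 - p) * v walk1 n + p * v rej (Suc n) \<le> v sweep (Suc n)"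
    and walk_left: "r walk1 + v walk2 1 \<le> v walk1 0" "r walk2 + v ret 0 \<le> v walk2 0"
    and walk: "\<And>s i. s = walk1 \<or> s = walk2 \<Longrightarrow> 1 \<le> i \<Longrightarrow> i \<le> n \<Longrightarrow> r s + v (Suc s) i \<le> v s i"
    and walk_right: "r walk1 + v ret (Suc n) \<le> v walk1 (Suc n)"
      "r walk2 + v coin (Suc n) \<le> v walk2 (Suc n)"
    and meas: "\<And>s i. s = walk1 \<or> s = walk2 \<Longrightarrow> 1 \<le> i \<Longrightarrow> i \<le> n \<Longrightarrow>
      r (Suc s) + v s (i - 1) / 2 + v s (Suc i) / 2 \<le> v (Suc s) i"
    and coin: "r coin + (1 - (sin \<theta>)\<^sup>2) * v ret (Suc n) + (sin \<theta>)\<^sup>2 * v acc (Suc n) \<le> v coin (Suc n)"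
    and halt: "\<And>i. i \<le> Suc n \<Longrightarrow> r acc \<le> v acc i" "\<And>i. i \<le> Suc n \<Longrightarrow> r rej \<le> v rej i"
  shows "(\<Sum>t. \<integral>\<^sup>+ c. ennreal (r (fst c)) \<partial>measure_spmf (run (length_automaton \<Sigma> m \<theta>) w t))
    \<le> ennreal (v ret 0)"
proof -
  let ?A = "length_automaton \<Sigma> m \<theta>"
  let ?V = "\<lambda>c :: (2, nat) config. ennreal (v (fst c) (fst (snd c)))"
  have "r s + (\<integral>\<^sup>+ c'. ?V c' \<partial>measure_pmf (step ?A w (s, i, ray \<alpha>))) \<le> ennreal (v s i)"
    if g: "good m \<theta> n s i \<alpha>" and s: "s \<noteq> acc" "s \<noteq> rej" for s i \<alpha>
  proof -
    note rot = step_rotation[of ?A s w i, where \<alpha> = \<alpha>]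
    have R: ?thesis
      if "step ?A w (s, i, ray \<alpha>) = return_pmf (s', j, \<psi>)" "r s + v s' j \<le> v s i" "j \<le> Suc n"
      for s' j \<psi>
      using that r v by (simp add: ennreal_leI flip: ennreal_plus)
    have M: ?thesis
      if "turn m \<theta> s (tape w i) = None" "move_of s (tape w i) 0 = (s0, d0)"
        "move_of s (tape w i) 1 = (s1, d1)"
        "r s + (cos \<alpha>)\<^sup>2 * v s0 (nat (int i + d0)) + (sin \<alpha>)\<^sup>2 * v s1 (nat (int i + d1)) \<le> v s i"
        "nat (int i + d0) \<le> Suc n" "nat (int i + d1) \<le> Suc n"
      for s0 d0 s1 d1
    proof -
      have th: "theta ?A s (tape w i) = Measure basis_measurement" using that(1) by simp
      have "0 \<le> v s0 (nat (int i + d0))" "0 \<le> v s1 (nat (int i + d1))"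
        using that v by auto
      hence "r s + (\<integral>\<^sup>+ c'. ?V c' \<partial>measure_pmf (step ?A w (s, i, ray \<alpha>))) =
          ennreal (r s + ((cos \<alpha>)\<^sup>2 * v s0 (nat (int i + d0)) + (sin \<alpha>)\<^sup>2 * v s1 (nat (int i + d1))))"
        using nn_integral_step_measure[OF th, where f = "\<lambda>s i. ennreal (v s i)" and \<alpha> = \<alpha>
            and ?s0.0 = s0 and ?d0.0 = d0 and ?s1.0 = s1 and ?d1.0 = d1] that(2,3) r
        by (simp add: ennreal_mult)
      also have "\<dots> \<le> ennreal (v s i)"
        using that(4) by (intro ennreal_leI) simp
      finally show ?thesis .
    qed
    from g[unfolded n] s show ?thesis
    proof (cases rule: good_cases)
      case ret_left
      thus ?thesis using rot[of "- m * (sqrt 2 * pi)"] assms(5)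
        by (intro R) (auto simp: turn_def move_of_def move_simps n)
    next
      case ret
      thus ?thesis using rot[of 0] assms(6)[of i]
        by (intro R[of ret "i - 1" "ray \<alpha>"]) (auto simp: turn_def move_of_def move_simps n)
    next
      case (sweep a)
      thus ?thesis using rot[of "sqrt 2 * pi"] assms(7)[of i]
        by (intro R) (auto simp: turn_def move_of_def move_simps n)
    next
      case sweep_right
      thus ?thesis using assms(8) p
        by (intro M[of walk1 "-1" rej 0])
          (auto simp: turn_def move_of_def cos_squared_eq nat_add_distrib n)
    next
      case walk_left
      show ?thesis
      proof (cases "s = walk1")
        case True
        thus ?thesis using walk_left rot[of "pi/2"] assms(9)
          by (intro R) (auto simp: turn_def move_of_def move_simps n)
      next
        case False
        thus ?thesis using walk_left rot[of 0] assms(10)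
          by (intro R) (auto simp: turn_def move_of_def move_simps n)
      qed
    next
      case (walk a)
      thus ?thesis using rot[of "pi/4"] assms(11)[of s i]
        by (intro R) (auto simp: turn_def move_of_def move_simps n)
    next
      case walk_right
      show ?thesis
      proof (cases "s = walk1")
        case True
        thus ?thesis using walk_right rot[of "pi/2"] assms(12)
          by (intro R) (auto simp: turn_def move_of_def move_simps n)
      next
        case False
        thus ?thesis using walk_right rot[of "\<theta> - pi/2"] assms(13)
          by (intro R) (auto simp: turn_def move_of_def move_simps n)
      qed
    next
      case (meas a)
      hence i: "nat (int i - 1) = i - 1" "nat (int i + 1) = Suc i"
        by (simp_all add: nat_diff_distrib nat_add_distrib)
      have half: "(cos \<alpha>)\<^sup>2 * x = x / 2" "(sin \<alpha>)\<^sup>2 * x = x / 2" for x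
        using meas(5,6) by simp_all
      show ?thesis using meas(1-4) assms(14)[of "s - 1" i]
        by (intro M[of "s - 1" "-1" "s - 1" 1]) (auto simp: turn_def move_of_def half i n)
    next
      case coin
      thus ?thesis using assms(15)
        by (intro M[of ret 0 acc 0]) (auto simp: turn_def move_of_def cos_squared_eq nat_add_distrib n)
    qed
  qed
  note one_step = this
  have "(\<Sum>t. \<integral>\<^sup>+ c. ennreal (r (fst c)) \<partial>measure_spmf (run ?A w t)) \<le> ?V (initial ?A)"
    using one_step halt
    by (intro suminf_reward_le_potential[OF invariant_length_automaton])
      (auto simp: n good_def intro!: ennreal_leI)
  thus ?thesis by (simp add: initial_length_automaton)
qed

section \<open>Bounds on running time, rejection and acceptance\<close>

text \<open>Turns running, acceptance and rejection probabilities into total rewards.\<close>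

lemma suminf_emeasure_run:
  "(\<Sum>t. emeasure (measure_spmf (run A w t)) {c. fst c \<in> H}) =
   (\<Sum>t. \<integral>\<^sup>+ c. ennreal (of_bool (fst c \<in> H)) \<partial>measure_spmf (run A w t))"
proof -
  have "emeasure (measure_spmf (run A w t)) {c. fst c \<in> H} =
      (\<integral>\<^sup>+ c. indicator {c. fst c \<in> H} c \<partial>measure_spmf (run A w t))" for t
    by simp
  also have "(\<integral>\<^sup>+ c. indicator {c. fst c \<in> H} c \<partial>measure_spmf (run A w t)) =
      (\<integral>\<^sup>+ c. ennreal (of_bool (fst c \<in> H)) \<partial>measure_spmf (run A w t))" for t
    by (intro nn_integral_cong) (simp add: indicator_def)
  finally show ?thesis by simp
qed

text \<open>With \<open>\<eta> = sin\<^sup>2 \<theta>\<close>: a walk step takes two transitions, so a walk from \<open>i\<close> lasts \<open>2 i (N - i)\<close> expected steps,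
  where \<open>N = n + 1\<close>.  A round accepts with probability at least \<open>(1 - p) \<eta> / N\<^sup>2\<close>, where \<open>p\<close> is the
  probability that it rejects, and lasts at most \<open>6 N\<close> expected steps.
  Hence \<open>\<tau>\<close> bounds the expected time from the start of a round.\<close>

lemma suminf_running_prob_length_automaton:
  fixes w :: "'a list"
  assumes "sin \<theta> \<noteq> 0"
  shows "(\<Sum>t. running_prob_at (length_automaton \<Sigma> m \<theta>) w t)
    \<le> ennreal (6 * real (Suc (length w)) ^ 3 / (sin \<theta>)\<^sup>2)"
proof -
  let ?A = "length_automaton \<Sigma> m \<theta> :: (2, nat, 'a) qcfa"
  define n where "n = length w"
  define N where "N = real (Suc n)"
  define \<eta> where "\<eta> = (sin \<theta>)\<^sup>2"
  define \<tau> where "\<tau> = 6 * N ^ 3 / \<eta>"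
  define p where "p = (sin ((real n - real m) * (sqrt 2 * pi)))\<^sup>2"
  \<comment> \<open>From \<open>i\<close> the first walk reaches 0 with probability
    \<open>(N - i) / N\<close>, the second then succeeds with \<open>1 / N\<close> and the coin with
    \<open>\<eta>\<close>; \<tau> is weighted by the complement. \<open>3 * N + 1\<close> makes
    \<open>W1 0 = 1 + W2 1\<close> exact and covers the way back after a failure.\<close>
  define W1 where "W1 i = 2 * real i * (N - real i) + 3 * N + 1 + \<tau> * (1 - \<eta> * (N - real i) / N\<^sup>2)" for i
  define W2 where "W2 i = 2 * real i * (N - real i) + N + 2 + \<tau> * (1 - \<eta> * real i / N)" for i
  have N: "N \<ge> 1" "real n = N - 1" by (auto simp: N_def)
  have \<eta>: "0 < \<eta>" "\<eta> \<le> 1" using assms by (auto simp: \<eta>_def abs_square_le_1)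
  have p: "0 \<le> p" "p \<le> 1" by (auto simp: p_def abs_square_le_1)
  have \<tau>: "0 < \<tau>" "\<tau> * \<eta> / N\<^sup>2 = 6 * N"
    using N \<eta> by (auto simp: \<tau>_def power2_eq_square power3_eq_cube)
  have le_1: "0 \<le> \<tau> * (1 - \<eta> * x)" if "0 \<le> x" "x \<le> 1" for x
    using \<tau> \<eta> that by (auto intro!: mult_nonneg_nonneg mult_le_one)
  have W1_ge: "1 \<le> W1 i" if "i \<le> Suc n" for i
  proof -
    have i: "0 \<le> real i" "real i \<le> N" using that by (auto simp: N_def)
    have "1 * N \<le> N * N" using N by (intro mult_right_mono) auto
    hence "N - real i \<le> N * N" using i by linarith
    hence "0 \<le> \<tau> * (1 - \<eta> * ((N - real i) / N\<^sup>2))"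
      using i N by (intro le_1) (auto simp: power2_eq_square)
    moreover have "0 \<le> 2 * real i * (N - real i)" using i by simp
    ultimately show ?thesis using N by (simp add: W1_def)
  qed
  have W2_ge: "1 \<le> W2 i" if "i \<le> Suc n" for i
  proof -
    have i: "0 \<le> real i" "real i \<le> N" using that by (auto simp: N_def)
    have "0 \<le> \<tau> * (1 - \<eta> * (real i / N))"
      using i N by (intro le_1) auto
    moreover have "0 \<le> 2 * real i * (N - real i)" using i by simp
    ultimately show ?thesis using N by (simp add: W2_def)
  qed
  \<comment> \<open>Terms linear in \<open>i\<close> average out; the quadratic one loses 2, paying
    for the walk state and the measuring state.\<close>
  have W1_mean: "W1 (i - 1) / 2 + W1 (Suc i) / 2 = W1 i - 2" if "1 \<le> i" for i
    using that N by (simp add: W1_def of_nat_diff field_simps power2_eq_square)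
  have W2_mean: "W2 (i - 1) / 2 + W2 (Suc i) / 2 = W2 i - 2" if "1 \<le> i" for i
    using that N by (simp add: W2_def of_nat_diff field_simps)
  have W1_n: "W1 n = 5 * N - 1 + \<tau> * (1 - \<eta> / N\<^sup>2)"
    unfolding W1_def N(2) by (simp add: algebra_simps)
  have W1_0: "1 + W2 1 = W1 0"
    using N by (simp add: W1_def W2_def algebra_simps power2_eq_square)
  have W_right: "W1 (Suc n) = 3 * N + 1 + \<tau>" "W2 (Suc n) = N + 2 + \<tau> * (1 - \<eta>)"
    using N by (auto simp: W1_def W2_def N_def[symmetric] simp del: of_nat_Suc)
  have W2_0: "W2 0 = N + 2 + \<tau>" by (simp add: W2_def)
  define v where "v s i =
    (if s = ret then real i + \<tau>
     else if s = sweep then N - real i + 1 + W1 n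
     else if s = walk1 then W1 i else if s = meas1 then W1 i - 1
     else if s = walk2 then W2 i else if s = meas2 then W2 i - 1
     else if s = coin then 1 + N + \<tau> * (1 - \<eta>)
     else 0)" for s i
  have "(\<Sum>t. running_prob_at ?A w t) =
      (\<Sum>t. \<integral>\<^sup>+ c. ennreal (of_bool (fst c \<in> - {acc, rej})) \<partial>measure_spmf (run ?A w t))"
    unfolding suminf_emeasure_run[symmetric] running_prob_at_def by simp
  also have "\<dots> \<le> ennreal (v ret 0)"
  proof (rule total_reward_length_automaton_le[where v = v, OF _ _ n_def p_def])
    fix s i assume "i \<le> Suc n"
    thus "0 \<le> v s i"
      using W1_ge[of i] W2_ge[of i] W1_ge[of n] \<tau> \<eta> N by (auto simp: v_def)
  next
    \<comment> \<open>Equality fixes the 6 in \<tau>: the round costs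
      \<open>1 + N + (5 * N - 1)\<close>, and \<open>\<tau> * \<eta> / N\<^sup>2 = 6 * N\<close>
      refunds it.\<close>
    show "of_bool (ret \<in> - {acc, rej}) + v sweep 1 \<le> v ret 0"
      using \<tau>(2) by (simp add: v_def W1_n algebra_simps)
  next
    \<comment> \<open>The potential of \<open>sweep\<close> counts as if no rejection occurred; this
      nonnegative term is the slack.\<close>
    have "p * (5 * N - 1 + \<tau> * (1 - \<eta> / N\<^sup>2)) \<ge> 0"
      using p W1_ge[of n] W1_n by simp
    thus "of_bool (sweep \<in> - {acc, rej}) + (1 - p) * v walk1 n + p * v rej (Suc n) \<le> v sweep (Suc n)"
      by (simp add: v_def W1_n N_def[symmetric] left_diff_distrib del: of_nat_Suc)
  next
    show "of_bool (coin \<in> - {acc, rej}) + (1 - (sin \<theta>)\<^sup>2) * v ret (Suc n) + (sin \<theta>)\<^sup>2 * v acc (Suc n)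
        \<le> v coin (Suc n)"
      unfolding \<eta>_def[symmetric] using N \<eta>
      by (simp add: v_def N_def[symmetric] algebra_simps del: of_nat_Suc)
  qed (use W1_mean W2_mean W1_0 W2_0 W_right N in
      \<open>auto simp: v_def N_def[symmetric] of_nat_diff simp del: of_nat_Suc\<close>)
  also have "v ret 0 = 6 * real (Suc (length w)) ^ 3 / (sin \<theta>)\<^sup>2"
    by (simp add: v_def \<tau>_def N_def n_def \<eta>_def)
  finally show ?thesis .
qed

text \<open>Here \<open>p\<close> is the square of \<open>sin 0\<close>, so the indicator of
  \<open>rej\<close> is itself a potential.\<close>

lemma reject_prob_length_automaton:
  assumes "length w = m"
  shows "reject_prob (length_automaton \<Sigma> m \<theta>) w = 0"
proof -
  let ?A = "length_automaton \<Sigma> m \<theta>"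
  have "reject_prob ?A w =
      (\<Sum>t. \<integral>\<^sup>+ c. ennreal (of_bool (fst c \<in> {rej})) \<partial>measure_spmf (run ?A w t))"
    unfolding suminf_emeasure_run[symmetric] reject_prob_def halt_prob_at_def by simp
  also have "\<dots> \<le> ennreal (of_bool (ret = rej))"
    by (rule total_reward_length_automaton_le[where v = "\<lambda>s i. of_bool (s = rej)", OF _ _ refl refl])
      (use assms in auto)
  finally show ?thesis by simp
qed

text \<open>By \<open>le\<close>, a surviving round accepts with probability at most \<epsilon>
  times that of rejecting, so the value \<epsilon> at the start of a round reproduces
  itself.\<close>

lemma accept_prob_length_automaton_le:
  fixes w :: "'a list" and \<epsilon> :: real
  assumes \<epsilon>: "0 < \<epsilon>" "\<epsilon> \<le> 1"
    and le: "(sin \<theta>)\<^sup>2 / (real (Suc (length w)))\<^sup>2 \<le>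
      \<epsilon> * (sin ((real (length w) - real m) * (sqrt 2 * pi)))\<^sup>2"
  shows "accept_prob (length_automaton \<Sigma> m \<theta>) w \<le> ennreal \<epsilon>"
proof -
  let ?A = "length_automaton \<Sigma> m \<theta> :: (2, nat, 'a) qcfa"
  define n where "n = length w"
  define N where "N = real (Suc n)"
  define \<eta> where "\<eta> = (sin \<theta>)\<^sup>2"
  define p where "p = (sin ((real n - real m) * (sqrt 2 * pi)))\<^sup>2"
  \<comment> \<open>Linear interpolation is harmonic for a fair walk; the end values are \<epsilon>
    where a walk fails, \<open>W2 1\<close> after the first success and the value of
    \<open>coin\<close> after the second.\<close>
  define W1 where "W1 i = \<epsilon> + (1 - \<epsilon>) * \<eta> * (N - real i) / N\<^sup>2" for i
  define W2 where "W2 i = \<epsilon> + (1 - \<epsilon>) * \<eta> * real i / N" for i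
  have N: "N \<ge> 1" "real n = N - 1" by (auto simp: N_def)
  have \<eta>: "0 \<le> \<eta>" by (auto simp: \<eta>_def)
  have p: "0 \<le> p" "p \<le> 1" by (auto simp: p_def abs_square_le_1)
  have W_ge: "0 \<le> W1 i" "0 \<le> W2 i" if "i \<le> Suc n" for i
  proof -
    have "0 \<le> N - real i" using that by (simp add: N_def)
    thus "0 \<le> W1 i" "0 \<le> W2 i"
      unfolding W1_def W2_def using \<epsilon> \<eta> N
      by (intro add_nonneg_nonneg divide_nonneg_nonneg mult_nonneg_nonneg; simp)+
  qed
  have W1_mean: "W1 (i - 1) / 2 + W1 (Suc i) / 2 = W1 i" if "1 \<le> i" for i
    using that N by (simp add: W1_def of_nat_diff field_simps power2_eq_square)
  have W2_mean: "W2 (i - 1) / 2 + W2 (Suc i) / 2 = W2 i" if "1 \<le> i" for i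
    using that N by (simp add: W2_def of_nat_diff field_simps)
  have W_0: "W2 1 = W1 0" "W2 0 = \<epsilon>"
    using N by (simp_all add: W1_def W2_def power2_eq_square)
  have W_right: "W1 (Suc n) = \<epsilon>" "W2 (Suc n) = \<epsilon> + (1 - \<epsilon>) * \<eta>"
    using N by (simp_all add: W1_def W2_def N_def[symmetric] del: of_nat_Suc)
  \<comment> \<open>Rejection has potential 0, and the loss \<open>\<epsilon> * p\<close> outweighs
    the excess of \<open>W1 n\<close> over \<epsilon>.\<close>
  have W1_n: "(1 - p) * W1 n \<le> \<epsilon>"
  proof -
    have le: "((1 - p) * (1 - \<epsilon>)) * (\<eta> / N\<^sup>2) \<le> 1 * (\<epsilon> * p)"
      using le \<epsilon> \<eta> p by (intro mult_mono mult_le_one) (auto simp: \<eta>_def N_def n_def p_def)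
    have "(1 - p) * W1 n = (1 - p) * (\<epsilon> + (1 - \<epsilon>) * (\<eta> / N\<^sup>2))"
      unfolding W1_def N(2) by simp
    also have "\<dots> = \<epsilon> - \<epsilon> * p + ((1 - p) * (1 - \<epsilon>)) * (\<eta> / N\<^sup>2)"
      by algebra
    finally show ?thesis using le by linarith
  qed
  define v where "v s i =
    (if s = ret \<or> s = sweep then \<epsilon>
     else if s = walk1 \<or> s = meas1 then W1 i
     else if s = walk2 \<or> s = meas2 then W2 i
     else if s = coin then \<epsilon> + (1 - \<epsilon>) * \<eta>
     else of_bool (s = acc))" for s i
  have "accept_prob ?A w =
      (\<Sum>t. \<integral>\<^sup>+ c. ennreal (of_bool (fst c \<in> {acc})) \<partial>measure_spmf (run ?A w t))"
    unfolding suminf_emeasure_run[symmetric] accept_prob_def halt_prob_at_def by simp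
  also have "\<dots> \<le> ennreal (v ret 0)"
  proof (rule total_reward_length_automaton_le[where v = v, OF _ _ n_def p_def])
    show "of_bool (coin \<in> {acc}) + (1 - (sin \<theta>)\<^sup>2) * v ret (Suc n) + (sin \<theta>)\<^sup>2 * v acc (Suc n)
        \<le> v coin (Suc n)"
      unfolding \<eta>_def[symmetric] by (simp add: v_def algebra_simps)
  qed (use W_ge W1_mean W2_mean W_0 W_right W1_n \<epsilon> \<eta> in \<open>auto simp: v_def\<close>)
  finally show ?thesis by (simp add: v_def)
qed

section \<open>Choice of the coin and assembly\<close>

theorem theorem8:
  "\<exists>(K::nat) (c::real). c > 0 \<and>
     (\<forall>(\<Sigma>::'a set) (m::nat) (\<epsilon>::real).
        finite \<Sigma> \<longrightarrow> m \<ge> 1 \<longrightarrow> 0 < \<epsilon> \<longrightarrow> \<epsilon> \<le> 1/2 \<longrightarrow>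
        (\<exists>A :: (2, nat, 'a) qcfa.
           is_2qcfa A \<and> alphabet A = \<Sigma> \<and>
           card (quantum_states A) = 2 \<and> card (states A) = K \<and>
           recognizes_one_sided A (words_of_length \<Sigma> m) \<epsilon> \<and>
           (\<forall>w\<in>lists \<Sigma>. length w \<ge> 1 \<longrightarrow>
              expected_time A w \<le> ennreal (c * (1/\<epsilon>) * real m ^ 2 * real (length w) ^ 4))))"
\<comment> \<open>\<open>768 = 6 * 8 * 16\<close>: 6 from the running-time bound, 8 from
  \<open>n + 1 \<le> 2 * n\<close> cubed, 16 from \<open>\<eta>\<close>; finally
  \<open>n^3 \<le> n^4\<close>.\<close>
proof (intro exI[of _ "9 :: nat"] exI[of _ "768 :: real"] conjI allI impI)
  fix \<Sigma> :: "'a set" and m :: nat and \<epsilon> :: real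
  assume fin: "finite \<Sigma>" and m: "m \<ge> 1" and \<epsilon>: "0 < \<epsilon>" "\<epsilon> \<le> 1/2"
  \<comment> \<open>16 matches the sine bound \<open>1 / (16 * d^2)\<close> and \<open>m^2\<close>
    the estimate \<open>\<bar>d\<bar> \<le> m * N\<close> for the length difference.\<close>
  define \<eta> where "\<eta> = \<epsilon> / (16 * real m ^ 2)"
  define \<theta> where "\<theta> = arcsin (sqrt \<eta>)"
  define A where "A = (length_automaton \<Sigma> m \<theta> :: (2, nat, 'a) qcfa)"
  have "1 \<le> real m ^ 2" using m by simp
  hence "0 < 16 * real m ^ 2" "\<epsilon> \<le> 16 * real m ^ 2" using \<epsilon> by linarith+
  hence \<eta>: "0 < \<eta>" "\<eta> \<le> 1" unfolding \<eta>_def using \<epsilon>(1) by (simp_all only: divide_pos_pos divide_le_eq_1_pos)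
  have "sin \<theta> = sqrt \<eta>" unfolding \<theta>_def
    using \<eta> by (intro sin_arcsin) (auto intro: order_trans[of _ 0])
  hence \<theta>: "(sin \<theta>)\<^sup>2 = \<eta>" "sin \<theta> \<noteq> 0" using \<eta> by auto
  have running: "(\<Sum>t. running_prob_at A w t) \<le> ennreal (6 * real (Suc (length w)) ^ 3 / \<eta>)" for w
    using suminf_running_prob_length_automaton[OF \<theta>(2), of \<Sigma> m w] by (simp only: A_def \<theta>(1))
  hence finite_time: "(\<Sum>t. running_prob_at A w t) < \<infinity>" for w
    by (rule le_less_trans) simp
  have acc_rej: "accept_prob A w + reject_prob A w = 1" for w
    using accept_prob_plus_reject_prob[OF _ finite_time] by (simp add: A_def)
  have accept: "accept_prob A w = 1" if "length w = m" for w
    using acc_rej[of w] reject_prob_length_automaton[OF that] by (simp add: A_def)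
  have reject: "ennreal (1 - \<epsilon>) \<le> reject_prob A w" if "length w \<noteq> m" for w
  proof -
    define d where "d = int (length w) - int m"
    define N where "N = real (Suc (length w))"
    have d: "d \<noteq> 0" "real_of_int d = real (length w) - real m" using that by (auto simp: d_def)
    have "\<bar>real_of_int d\<bar> \<le> real m * N"
    proof -
      have "real (length w) \<le> real m * N" "real m \<le> real m * N"
        using m mult_mono[of 1 "real m" "real (length w)" N] by (auto simp: N_def)
      thus ?thesis by (simp add: d(2))
    qed
    hence "(real_of_int d)\<^sup>2 \<le> (real m * N)\<^sup>2" by (simp flip: abs_le_square_iff)
    hence "\<eta> / N\<^sup>2 \<le> \<epsilon> * (1 / (16 * (real_of_int d)\<^sup>2))"
      using d(1) \<epsilon> m by (simp add: \<eta>_def N_def field_simps del: of_nat_Suc)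
    also have "\<dots> \<le> \<epsilon> * (sin (d * (sqrt 2 * pi)))\<^sup>2"
      using sin_squared_sqrt2_pi_ge[OF d(1)] \<epsilon> by (intro mult_left_mono) auto
    finally have "accept_prob A w \<le> ennreal \<epsilon>"
      unfolding A_def N_def d(2) \<theta>(1)[symmetric] using \<epsilon>
      by (intro accept_prob_length_automaton_le) auto
    hence "1 \<le> ennreal \<epsilon> + reject_prob A w"
      unfolding acc_rej[of w, symmetric] by (rule add_right_mono)
    hence "1 - ennreal \<epsilon> \<le> reject_prob A w"
      by (simp add: ennreal_minus_le_iff)
    thus ?thesis using \<epsilon> by (simp add: ennreal_minus flip: ennreal_1)
  qed
  have time: "expected_time A w \<le> ennreal (768 * (1/\<epsilon>) * real m ^ 2 * real (length w) ^ 4)"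
    if "length w \<ge> 1" for w
  proof -
    define n where "n = real (length w)"
    have n: "1 \<le> n" using that by (simp add: n_def)
    have "real (Suc (length w)) ^ 3 \<le> (2 * n) ^ 3"
      using n by (intro power_mono) (auto simp: n_def)
    also have "\<dots> \<le> 8 * n ^ 4"
      using n power_increasing[of 3 4 n] by (simp add: power_mult_distrib)
    finally have "6 * real (Suc (length w)) ^ 3 / \<eta> \<le> 6 * (8 * n ^ 4) / \<eta>"
      using \<eta> by (intro divide_right_mono mult_left_mono) auto
    also have "\<dots> = 768 * (1/\<epsilon>) * real m ^ 2 * n ^ 4"
      by (simp add: \<eta>_def)
    finally have "ennreal (6 * real (Suc (length w)) ^ 3 / \<eta>) \<le> ennreal (768 * (1/\<epsilon>) * real m ^ 2 * n ^ 4)"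
      by (rule ennreal_leI)
    thus ?thesis
      unfolding n_def using expected_time_le[OF finite_time] running by (blast intro: order_trans)
  qed
  show "\<exists>A :: (2, nat, 'a) qcfa.
           is_2qcfa A \<and> alphabet A = \<Sigma> \<and>
           card (quantum_states A) = 2 \<and> card (states A) = 9 \<and>
           recognizes_one_sided A (words_of_length \<Sigma> m) \<epsilon> \<and>
           (\<forall>w\<in>lists \<Sigma>. length w \<ge> 1 \<longrightarrow>
              expected_time A w \<le> ennreal (768 * (1/\<epsilon>) * real m ^ 2 * real (length w) ^ 4))"
    using is_2qcfa_length_automaton[OF fin] accept reject time
    by (intro exI[of _ A])
      (auto simp: A_def recognizes_one_sided_def words_of_length_def quantum_states_def)
qed simp

end
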